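(* Let $\mathcal{H}_{\mathrm{s}}$ and $\mathcal{H}_{\mathrm{e}}$ be finite-dimensional complex Hilbert spaces of dimensions $n_{\mathrm{s}}$ and $n_{\mathrm{e}}$, let $\mathcal{H}_{\mathrm{c}} = \mathcal{H}_{\mathrm{s}} \otimes \mathcal{H}_{\mathrm{e}}$ and $n = n_{\mathrm{s}} n_{\mathrm{e}}$. For all $U, V \in \mathrm{U}(\mathcal{H}_{\mathrm{c}})$, the Hilbert-Schmidt quotient distance $$\tilde{\Delta}_{\mathrm{HS}}([U],[V]) := \frac{1}{\sqrt{2n}} \min_{\Phi \in \mathrm{U}(\mathcal{H}_{\mathrm{e}})} \| U - (\mathbb{1}_{\mathrm{s}} \otimes \Phi) V \|_{\mathrm{HS}}$$ satisfies $$\tilde{\Delta}_{\mathrm{HS}}([U],[V]) = \left( 1 - \frac{1}{n} \| \Gamma \|_{\mathrm{Tr}} \right)^{1/2}, \qquad \text{where } \Gamma := \mathrm{Tr}_{\mathrm{s}}(U V^{\dagger}).$$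
   Context: $\mathrm{U}(\mathcal{H})$ is the group of unitary operators on $\mathcal{H}$, and $\mathbb{1}_{\mathrm{s}}$ is the identity operator on $\mathcal{H}_{\mathrm{s}}$. $[U] = \{(\mathbb{1}_{\mathrm{s}} \otimes \Phi) U : \Phi \in \mathrm{U}(\mathcal{H}_{\mathrm{e}})\}$ is the equivalence class of $U$. $\|M\|_{\mathrm{HS}} = \sqrt{\mathrm{Tr}(M^{\dagger} M)}$ is the Hilbert-Schmidt (Frobenius) norm, and $\|M\|_{\mathrm{Tr}} = \mathrm{Tr}(\sqrt{M^{\dagger} M})$ is the trace norm (the sum of the singular values of $M$). $\mathrm{Tr}_{\mathrm{s}}$ is the partial trace over $\mathcal{H}_{\mathrm{s}}$, the linear map from operators on $\mathcal{H}_{\mathrm{s}} \otimes \mathcal{H}_{\mathrm{e}}$ to operators on $\mathcal{H}_{\mathrm{e}}$ with $\mathrm{Tr}_{\mathrm{s}}(A \otimes B) = \mathrm{Tr}(A) B$. *)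

theory Defs
  imports "HOL-Analysis.Analysis"
begin

(* Operators are represented by their matrices in an orthonormal basis: 's and 'e index
   orthonormal bases of H_s and H_e, and the product type indexes the product basis of the
   tensor product. *)

definition dagger :: "complex ^ 'n ^ 'm \<Rightarrow> complex ^ 'm ^ 'n"
  where "dagger M = (\<chi> i j. cnj (M $ j $ i))"

definition unitary_group :: "(complex ^ 'n ^ 'n) set"
  where "unitary_group = {U. dagger U ** U = mat 1 \<and> U ** dagger U = mat 1}"

definition kron :: "complex ^ 's ^ 's \<Rightarrow> complex ^ 'e ^ 'e \<Rightarrow> complex ^ ('s \<times> 'e) ^ ('s \<times> 'e)"
    (infixl "\<otimes>" 72)
  where "A \<otimes> B = (\<chi> p q. A $ fst p $ fst q * B $ snd p $ snd q)"

definition psd :: "complex ^ 'n ^ 'n \<Rightarrow> bool"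
  where "psd M \<longleftrightarrow> dagger M = M \<and> (\<forall>v. 0 \<le> Re (\<Sum>i\<in>UNIV. cnj (v $ i) * (M *v v) $ i))"

(* The positive semidefinite square root; meaningful for positive semidefinite M only. *)
definition psd_sqrt :: "complex ^ 'n ^ 'n \<Rightarrow> complex ^ 'n ^ 'n"
  where "psd_sqrt M = (THE S. psd S \<and> S ** S = M)"

(* The traces in the two norms are real and nonnegative; Re only changes their type. *)

definition hs_norm :: "complex ^ 'n ^ 'n \<Rightarrow> real"
  where "hs_norm M = sqrt (Re (trace (dagger M ** M)))"

definition trace_norm :: "complex ^ 'n ^ 'n \<Rightarrow> real"
  where "trace_norm M = Re (trace (psd_sqrt (dagger M ** M)))"

definition ptrace_s :: "complex ^ ('s::finite \<times> 'e::finite) ^ ('s \<times> 'e) \<Rightarrow> complex ^ 'e ^ 'e"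
  where "ptrace_s M = (\<chi> i j. \<Sum>k\<in>UNIV. M $ (k, i) $ (k, j))"

definition operator_class ::
    "complex ^ ('s::finite \<times> 'e::finite) ^ ('s \<times> 'e) \<Rightarrow> (complex ^ ('s \<times> 'e) ^ ('s \<times> 'e)) set"
  where "operator_class U = {(mat 1 \<otimes> \<Phi>) ** U | \<Phi>. \<Phi> \<in> unitary_group}"

(* LEAST of a set of reals is its minimum; it is unspecified if the minimum is not attained. *)
definition hs_rep_dist ::
    "complex ^ ('s::finite \<times> 'e::finite) ^ ('s \<times> 'e) \<Rightarrow> complex ^ ('s \<times> 'e) ^ ('s \<times> 'e) \<Rightarrow> real"
  where "hs_rep_dist U V = 1 / sqrt (2 * (real CARD('s) * real CARD('e)))
    * (LEAST d. \<exists>\<Phi> \<in> unitary_group. d = hs_norm (U - (mat 1 \<otimes> \<Phi>) ** V))"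

(* The value of hs_rep_dist on any representatives; see hs_quotient_dist_operator_class. *)
definition hs_quotient_dist ::
    "(complex ^ ('s::finite \<times> 'e::finite) ^ ('s \<times> 'e)) set \<Rightarrow> (complex ^ ('s \<times> 'e) ^ ('s \<times> 'e)) set \<Rightarrow> real"
  where "hs_quotient_dist C D = (THE d. \<exists>U \<in> unitary_group. \<exists>V \<in> unitary_group.
    C = operator_class U \<and> D = operator_class V \<and> d = hs_rep_dist U V)"

lemma ptrace_s_add: "ptrace_s (A + B) = ptrace_s A + ptrace_s B"
  by (simp add: ptrace_s_def vec_eq_iff sum.distrib)

lemma ptrace_s_scale: "ptrace_s (mat c ** A) = mat c ** ptrace_s A"
proof -
  have scale: "(mat c ** M) $ i $ j = c * M $ i $ j" for M :: "complex ^ 'n ^ 'n" and i j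
    by (simp add: matrix_matrix_mult_def mat_def if_distrib[of "\<lambda>x. x * _"] cong: if_cong)
  show ?thesis
    by (simp add: vec_eq_iff scale, simp add: ptrace_s_def scale sum_distrib_left)
qed

lemma ptrace_s_kron: "ptrace_s (A \<otimes> B) = mat (trace A) ** B"
  by (simp add: ptrace_s_def kron_def trace_def vec_eq_iff matrix_matrix_mult_def mat_def
      sum_distrib_right if_distrib[of "\<lambda>x. x * _"] cong: if_cong)

lemma ptrace_s_unique:
  fixes T :: "complex ^ ('s::finite \<times> 'e::finite) ^ ('s \<times> 'e) \<Rightarrow> complex ^ 'e ^ 'e"
  assumes add: "\<And>A B. T (A + B) = T A + T B"
    and scale: "\<And>c A. T (mat c ** A) = mat c ** T A"
    and kron: "\<And>A B. T (A \<otimes> B) = mat (trace A) ** B"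
  shows "T = ptrace_s"
proof
  fix M :: "complex ^ ('s \<times> 'e) ^ ('s \<times> 'e)"
  define E :: "'s \<times> 'e \<Rightarrow> 's \<times> 'e \<Rightarrow> complex ^ ('s \<times> 'e) ^ ('s \<times> 'e)"
    where "E p q = (\<chi> i j. if i = fst p \<and> j = fst q then 1 else 0)
      \<otimes> (\<chi> i j. if i = snd p \<and> j = snd q then 1 else 0)" for p q
  have E: "E p q $ i $ j = (if i = p \<and> j = q then 1 else 0)" for p q i j
    by (auto simp: E_def kron_def prod_eq_iff)
  have TE: "T (E p q) = ptrace_s (E p q)" for p q
    unfolding E_def by (simp add: kron ptrace_s_kron)
  have dec: "M = (\<Sum>p\<in>UNIV. \<Sum>q\<in>UNIV. mat (M $ p $ q) ** E p q)"
  proof -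
    have sc: "(mat (M $ p $ q) ** E p q) $ i $ j = (if q = j then if p = i then M $ p $ q else 0 else 0)"
      for p q i j
      by (simp add: matrix_matrix_mult_def mat_def E if_distrib[of "\<lambda>x. x * _"] cong: if_cong)
    show ?thesis
      by (simp add: vec_eq_iff sc sum.delta)
  qed
  have zero: "S 0 = 0" if "\<And>A B. S (A + B) = S A + S B"
    for S :: "complex ^ ('s \<times> 'e) ^ ('s \<times> 'e) \<Rightarrow> complex ^ 'e ^ 'e"
    using that[of 0 0] by simp
  have sm: "S (sum f A) = (\<Sum>a\<in>A. S (f a))" if "\<And>A B. S (A + B) = S A + S B" "finite A"
    for S :: "complex ^ ('s \<times> 'e) ^ ('s \<times> 'e) \<Rightarrow> complex ^ 'e ^ 'e"
      and f :: "'s \<times> 'e \<Rightarrow> _" and A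
    using that(2) by (induction A rule: finite_induct) (simp_all add: that(1) zero)
  have "T M = (\<Sum>p\<in>UNIV. \<Sum>q\<in>UNIV. mat (M $ p $ q) ** T (E p q))"
    by (subst dec) (simp add: sm add scale)
  moreover have "ptrace_s M = (\<Sum>p\<in>UNIV. \<Sum>q\<in>UNIV. mat (M $ p $ q) ** ptrace_s (E p q))"
    by (subst dec) (simp add: sm ptrace_s_add ptrace_s_scale)
  ultimately show "T M = ptrace_s M" by (simp add: TE)
qed

lemma dagger_mult: "dagger (A ** B) = dagger B ** dagger A"
  by (simp add: dagger_def matrix_matrix_mult_def vec_eq_iff mult.commute)

lemma dagger_dagger [simp]: "dagger (dagger A) = A"
  by (simp add: dagger_def vec_eq_iff)

lemma mat_1_unitary: "mat 1 \<in> unitary_group"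
proof -
  have "dagger (mat 1 :: complex ^ 'n ^ 'n) = mat 1"
    by (simp add: dagger_def mat_def vec_eq_iff)
  then show ?thesis by (simp add: unitary_group_def)
qed

lemma dagger_unitary: "U \<in> unitary_group \<Longrightarrow> dagger U \<in> unitary_group"
  by (simp add: unitary_group_def)

lemma mult_unitary: "U \<in> unitary_group \<Longrightarrow> V \<in> unitary_group \<Longrightarrow> U ** V \<in> unitary_group"
  unfolding unitary_group_def mem_Collect_eq dagger_mult
  by (metis matrix_mul_assoc matrix_mul_rid)

lemma kron_1_mult: "(mat 1 \<otimes> A) ** (mat 1 \<otimes> B) = mat 1 \<otimes> (A ** B)"
proof -
  have "(\<Sum>r\<in>UNIV. (mat 1 \<otimes> A) $ p $ r * (mat 1 \<otimes> B) $ r $ q)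
      = (\<Sum>x\<in>UNIV. \<Sum>y\<in>UNIV. (mat 1 \<otimes> A) $ p $ (x, y) * (mat 1 \<otimes> B) $ (x, y) $ q)" for p q
    by (simp add: sum.cartesian_product)
  also have "\<dots> p q = (\<Sum>x\<in>UNIV. if x = fst p
      then \<Sum>y\<in>UNIV. A $ snd p $ y * (if fst p = fst q then B $ y $ snd q else 0) else 0)" for p q
    by (intro sum.cong) (auto simp: kron_def mat_def)
  finally have *: "((mat 1 \<otimes> A) ** (mat 1 \<otimes> B)) $ p $ q = (\<Sum>y\<in>UNIV. A $ snd p $ y * (if fst p = fst q then B $ y $ snd q else 0))" for p q
    by (simp add: matrix_matrix_mult_def)
  show ?thesis
    unfolding vec_eq_iff * by (simp add: kron_def mat_def matrix_matrix_mult_def)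
qed

lemma kron_1_1: "mat 1 \<otimes> mat 1 = mat 1"
  by (auto simp: kron_def mat_def vec_eq_iff prod_eq_iff)

lemma dagger_kron_1: "dagger (mat 1 \<otimes> A) = mat 1 \<otimes> dagger A"
  by (simp add: dagger_def kron_def mat_def vec_eq_iff)

lemma kron_1_unitary: "A \<in> unitary_group \<Longrightarrow> mat 1 \<otimes> A \<in> unitary_group"
  by (simp add: unitary_group_def dagger_kron_1 kron_1_mult kron_1_1)

lemma hs_norm_unitary_mult: "W \<in> unitary_group \<Longrightarrow> hs_norm (W ** M) = hs_norm M"
  unfolding hs_norm_def unitary_group_def mem_Collect_eq dagger_mult
  by (metis matrix_mul_assoc matrix_mul_rid)

lemma hs_rep_dist_representatives:
  fixes U V :: "complex ^ ('s::finite \<times> 'e::finite) ^ ('s \<times> 'e)"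
  assumes "A \<in> unitary_group" "B \<in> unitary_group"
  shows "hs_rep_dist ((mat 1 \<otimes> A) ** U) ((mat 1 \<otimes> B) ** V) = hs_rep_dist U V"
proof -
  have ex: "\<exists>\<Phi>' \<in> unitary_group. hs_norm ((mat 1 \<otimes> A) ** U - (mat 1 \<otimes> \<Phi>) ** ((mat 1 \<otimes> B) ** V))
      = hs_norm (U - (mat 1 \<otimes> \<Phi>') ** V)"
    if "A \<in> unitary_group" "B \<in> unitary_group" "\<Phi> \<in> unitary_group"
    for A B \<Phi> and U V :: "complex ^ ('s \<times> 'e) ^ ('s \<times> 'e)"
  proof (intro bexI)
    let ?P = "dagger A ** (\<Phi> ** B)"
    show "?P \<in> unitary_group" using that by (intro mult_unitary dagger_unitary)
    have AA: "A ** dagger A = mat 1" using that by (simp add: unitary_group_def)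
    have "A ** ?P = \<Phi> ** B" using AA by (simp add: matrix_mul_assoc)
    then have "(mat 1 \<otimes> A) ** ((mat 1 \<otimes> ?P) ** V) = (mat 1 \<otimes> \<Phi>) ** ((mat 1 \<otimes> B) ** V)"
      by (simp add: matrix_mul_assoc kron_1_mult)
    then have "(mat 1 \<otimes> A) ** U - (mat 1 \<otimes> \<Phi>) ** ((mat 1 \<otimes> B) ** V)
        = (mat 1 \<otimes> A) ** (U - (mat 1 \<otimes> ?P) ** V)"
      by (simp add: matrix_matrix_mult_def vec_eq_iff right_diff_distrib sum_subtractf)
    then show "hs_norm ((mat 1 \<otimes> A) ** U - (mat 1 \<otimes> \<Phi>) ** ((mat 1 \<otimes> B) ** V))
      = hs_norm (U - (mat 1 \<otimes> ?P) ** V)"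
      using that by (simp add: hs_norm_unitary_mult kron_1_unitary)
  qed
  have inv: "(mat 1 \<otimes> dagger C) ** ((mat 1 \<otimes> C) ** W) = W" if "C \<in> unitary_group"
    for C and W :: "complex ^ ('s \<times> 'e) ^ ('s \<times> 'e)"
    using that by (simp add: matrix_mul_assoc kron_1_mult unitary_group_def kron_1_1)
  have "(\<exists>\<Phi> \<in> unitary_group. d = hs_norm ((mat 1 \<otimes> A) ** U - (mat 1 \<otimes> \<Phi>) ** ((mat 1 \<otimes> B) ** V)))
      \<longleftrightarrow> (\<exists>\<Phi> \<in> unitary_group. d = hs_norm (U - (mat 1 \<otimes> \<Phi>) ** V))" for d
    using ex[OF assms, of _ U V]
      ex[OF dagger_unitary[OF assms(1)] dagger_unitary[OF assms(2)],
        of _ "(mat 1 \<otimes> A) ** U" "(mat 1 \<otimes> B) ** V"]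
    unfolding inv[OF assms(1)] inv[OF assms(2)] by metis
  then show ?thesis by (simp add: hs_rep_dist_def)
qed

lemma operator_class_eqD:
  assumes "operator_class U = operator_class U'"
  obtains A where "A \<in> unitary_group" "U = (mat 1 \<otimes> A) ** U'"
proof -
  have "U = (mat 1 \<otimes> mat 1) ** U" by (simp add: kron_1_1)
  then have "U \<in> operator_class U" unfolding operator_class_def using mat_1_unitary by blast
  then show ?thesis using that unfolding assms by (auto simp: operator_class_def)
qed

lemma hs_quotient_dist_operator_class:
  assumes "U \<in> unitary_group" "V \<in> unitary_group"
  shows "hs_quotient_dist (operator_class U) (operator_class V) = hs_rep_dist U V"
  unfolding hs_quotient_dist_def
proof (rule the_equality)
  show "\<exists>U' \<in> unitary_group. \<exists>V' \<in> unitary_group. operator_class U = operator_class U'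
      \<and> operator_class V = operator_class V' \<and> hs_rep_dist U V = hs_rep_dist U' V'"
    using assms by blast
next
  fix d
  assume "\<exists>U' \<in> unitary_group. \<exists>V' \<in> unitary_group. operator_class U = operator_class U'
      \<and> operator_class V = operator_class V' \<and> d = hs_rep_dist U' V'"
  then show "d = hs_rep_dist U V"
    by (metis operator_class_eqD hs_rep_dist_representatives)
qed

end

(* The Hilbert-Schmidt norm is the norm of the real inner product Re Tr(A^dagger B), so minimizing
   the distance means maximizing the inner product of \<Phi> and \<Gamma> over the compact unitary group.
   At a maximizer \<Phi>, no unitary W gives Re Tr(W P) more than Re Tr P, where
   P = \<Phi>^dagger \<Gamma>; testing this with rank-one perturbations W of the identity shows that P is
   positive semidefinite. Hence \<Gamma> = \<Phi> P is a polar decomposition, and the maximum Tr P is the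
   trace norm of \<Gamma> by uniqueness of positive semidefinite square roots. *)
theory Submission
  imports Defs
begin

section \<open>The real inner product on complex matrices and its adjoint rules\<close>

lemma inner_vec_cnj: "inner v w = Re (\<Sum>i\<in>UNIV. cnj (v $ i) * w $ i)"
  by (simp add: inner_vec_def inner_complex_def)

lemma inner_matrix_cnj: "inner A B = Re (\<Sum>i\<in>UNIV. \<Sum>j\<in>UNIV. cnj (A $ i $ j) * B $ i $ j)"
  by (simp add: inner_vec_def inner_complex_def)

lemma inner_matrix_trace:
  fixes A B :: "complex ^ 'n ^ 'm"
  shows "inner A B = Re (trace (dagger A ** B))"
  unfolding inner_matrix_cnj trace_def matrix_matrix_mult_def dagger_def
  by (subst sum.swap) simp

lemma hs_norm_eq_norm: "hs_norm M = norm M"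
  by (simp add: hs_norm_def norm_eq_sqrt_inner inner_matrix_trace)

lemma inner_matrix_mult_left:
  fixes A :: "complex ^ 'n ^ 'm" and B :: "complex ^ 'k ^ 'n"
  shows "inner (A ** B) C = inner B (dagger A ** C)"
  by (simp add: inner_matrix_trace dagger_mult matrix_mul_assoc)

lemma inner_matrix_mult_right:
  fixes A :: "complex ^ 'n ^ 'm" and B :: "complex ^ 'm ^ 'n"
  shows "inner (A ** B) C = inner A (C ** dagger B)"
  by (simp add: inner_matrix_trace dagger_mult matrix_mul_assoc trace_mul_sym[of _ "dagger B"])

lemma inner_matrix_vector_mult:
  fixes A :: "complex ^ 'n ^ 'm"
  shows "inner (A *v x) y = inner x (dagger A *v y)"
proof -
  have "(\<Sum>i\<in>UNIV. cnj ((A *v x) $ i) * y $ i)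
      = (\<Sum>i\<in>UNIV. \<Sum>j\<in>UNIV. cnj (A $ i $ j) * cnj (x $ j) * y $ i)"
    by (simp add: matrix_vector_mult_def sum_distrib_right)
  also have "\<dots> = (\<Sum>j\<in>UNIV. \<Sum>i\<in>UNIV. cnj (A $ i $ j) * cnj (x $ j) * y $ i)"
    by (rule sum.swap)
  also have "\<dots> = (\<Sum>j\<in>UNIV. cnj (x $ j) * (dagger A *v y) $ j)"
    by (simp add: matrix_vector_mult_def dagger_def sum_distrib_left mult_ac)
  finally show ?thesis by (simp add: inner_vec_cnj)
qed

section \<open>Positive semidefinite matrices and uniqueness of their square roots\<close>

lemma psd_iff_inner: "psd M \<longleftrightarrow> dagger M = M \<and> (\<forall>v. 0 \<le> inner v (M *v v))"
  by (simp add: psd_def inner_vec_cnj)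

lemma psd_kernel:
  assumes "psd M" and "inner v (M *v v) = 0"
  shows "M *v v = 0"
proof -
  define w where "w = M *v v"
  define b where "b = inner w (M *v w)"
  have b: "0 \<le> b" using assms(1) by (simp add: b_def psd_iff_inner)
  have sym: "inner (M *v x) y = inner x (M *v y)" for x y
    using assms(1) inner_matrix_vector_mult[of M x y] by (simp add: psd_def)
  \<comment> \<open>Expand the form at \<open>v - t w\<close>: the linear term must be dominated for all \<open>t\<close>.\<close>
  have "2 * t * inner w w \<le> t\<^sup>2 * b" for t :: real
  proof -
    have "M *v (v - t *\<^sub>R w) = w - t *\<^sub>R (M *v w)"
      unfolding w_def matrix_vector_mult_def
      by (simp add: vec_eq_iff right_diff_distrib sum_subtractf flip: scaleR_sum_right)
    then have "0 \<le> inner (v - t *\<^sub>R w) (w - t *\<^sub>R (M *v w))"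
      using assms(1) by (metis psd_iff_inner)
    moreover have "inner v (M *v w) = inner w w"
      using sym[of v w] by (simp add: w_def)
    moreover have "inner v w = 0" using assms(2) by (simp add: w_def)
    ultimately show ?thesis
      by (simp add: inner_diff_left inner_diff_right b_def power2_eq_square algebra_simps)
  qed
  \<comment> \<open>The optimal \<open>t\<close> would have denominator \<open>b\<close>;
    \<open>b + 1\<close> also covers \<open>b = 0\<close> and still forces
    \<open>inner w w = 0\<close>.\<close>
  from this[of "inner w w / (b + 1)"] b
  have "2 * (inner w w)\<^sup>2 * (b + 1) \<le> (inner w w)\<^sup>2 * b"
    by (simp add: divide_simps power2_eq_square)
  moreover have "(inner w w)\<^sup>2 * b \<le> (inner w w)\<^sup>2 * (b + 1)"
    by (simp add: mult_left_mono)
  ultimately have "(inner w w)\<^sup>2 * (b + 1) \<le> 0" by simp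
  then have "(inner w w)\<^sup>2 \<le> 0" using b by (simp add: mult_le_0_iff)
  then show ?thesis by (simp add: w_def)
qed

lemma column_matrix_mult: "column j (A ** B) = A *v column j B"
  by (simp add: column_def matrix_matrix_mult_def matrix_vector_mult_def)

text \<open>Left multiplication acts column by column, so this reduces
  \<open>inner D (M ** D)\<close> to the quadratic form of \<open>M\<close> at the columns of
  \<open>D\<close>.\<close>

lemma inner_matrix_columns:
  fixes A B :: "complex ^ 'n ^ 'm"
  shows "inner A B = (\<Sum>j\<in>UNIV. inner (column j A) (column j B))"
  unfolding inner_vec_def column_def by (subst sum.swap) simp

lemma psd_inner_mult_nonneg: "psd M \<Longrightarrow> 0 \<le> inner D (M ** D)"
  by (simp add: inner_matrix_columns column_matrix_mult psd_iff_inner sum_nonneg)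

lemma psd_inner_mult_eq_0:
  fixes M :: "complex ^ 'n ^ 'n" and D :: "complex ^ 'm ^ 'n"
  assumes "psd M" and "inner D (M ** D) = 0"
  shows "M ** D = 0"
proof -
  have "inner (column j D) (M *v column j D) = 0" for j
    using assms sum_nonneg_eq_0_iff[of UNIV "\<lambda>j. inner (column j D) (M *v column j D)"]
    by (simp add: inner_matrix_columns column_matrix_mult psd_iff_inner)
  then have "column j (M ** D) = 0" for j
    using psd_kernel[OF assms(1)] by (simp add: column_matrix_mult)
  then show ?thesis by (simp add: column_def vec_eq_iff)
qed

lemma matrix_diff_ldistrib:
  fixes A :: "complex ^ 'n ^ 'm"
  shows "A ** (B - C) = A ** B - A ** C"
  by (simp add: matrix_matrix_mult_def vec_eq_iff right_diff_distrib sum_subtractf)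

lemma matrix_diff_rdistrib:
  fixes A :: "complex ^ 'n ^ 'm"
  shows "(A - B) ** C = A ** C - B ** C"
  by (simp add: matrix_matrix_mult_def vec_eq_iff left_diff_distrib sum_subtractf)

text \<open>With \<open>D = S - T\<close>, the hypothesis gives \<open>S D = - D T\<close>, so the nonnegative numbers
  \<open>Tr (D S D)\<close> and \<open>Tr (D T D)\<close> add up to zero; then \<open>S D = T D = 0\<close> and \<open>D\<^sup>2 = 0\<close>.\<close>
lemma psd_square_inject:
  assumes S: "psd S" and T: "psd T" and eq: "S ** S = T ** T"
  shows "S = T"
proof -
  define D where "D = S - T"
  have D: "dagger D = D"
    using S T by (simp add: psd_def D_def dagger_def vec_eq_iff)
  have T': "dagger T = T" using T by (simp add: psd_def)
  have "S ** D = - (D ** T)"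
    by (simp add: D_def matrix_diff_ldistrib matrix_diff_rdistrib eq)
  then have "inner D (S ** D) = - inner D (D ** T)" by simp
  \<comment> \<open>Since \<open>D\<close> is Hermitian, the two sides are the real parts of Tr(D D
    T) and Tr(D T D), equal by cyclicity.\<close>
  also have "inner D (D ** T) = inner D (T ** D)"
    using inner_matrix_mult_right[of D T D] inner_matrix_mult_left[of D D T]
      inner_matrix_mult_left[of D T D]
    by (metis D T' inner_commute inner_matrix_trace trace_mul_sym dagger_mult matrix_mul_assoc)
  finally have "inner D (S ** D) = 0" "inner D (T ** D) = 0"
    using psd_inner_mult_nonneg[OF S, of D] psd_inner_mult_nonneg[OF T, of D] by auto
  then have "S ** D = 0" "T ** D = 0"
    using psd_inner_mult_eq_0 S T by blast+
  then have "D ** D = 0" by (simp add: D_def matrix_diff_rdistrib)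
  then have "inner D D = 0"
    using inner_matrix_trace[of D D] by (simp add: D trace_def)
  then show ?thesis by (simp add: D_def)
qed

lemma psd_sqrt_square: "psd P \<Longrightarrow> psd_sqrt (P ** P) = P"
  unfolding psd_sqrt_def by (rule the_equality) (auto intro: psd_square_inject)

section \<open>Maximizing a real linear functional over the unitary group\<close>

lemma inner_unitary_self:
  fixes W :: "complex ^ 'n ^ 'n"
  shows "W \<in> unitary_group \<Longrightarrow> inner W W = real CARD('n)"
  by (simp add: inner_matrix_trace unitary_group_def trace_def mat_def)

lemma compact_unitary_group: "compact (unitary_group :: (complex ^ 'n ^ 'n) set)"
proof -
  have "bounded (unitary_group :: (complex ^ 'n ^ 'n) set)"
    unfolding bounded_iff by (rule exI[of _ "sqrt (real CARD('n))"]) (simp add: norm_eq_sqrt_inner inner_unitary_self)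
  moreover have "closed (unitary_group :: (complex ^ 'n ^ 'n) set)"
    unfolding unitary_group_def matrix_matrix_mult_def dagger_def
    by (intro closed_Collect_conj closed_Collect_eq continuous_intros)
  ultimately show ?thesis by (simp add: compact_eq_bounded_closed)
qed

text \<open>The matrix multiplies \<open>v\<close> by the phase \<open>c\<close> and fixes the
  orthogonal complement of \<open>v\<close>.\<close>

lemma unitary_rank_one_update:
  fixes v :: "complex ^ 'n" and c :: complex
  assumes "v \<noteq> 0" and c: "cmod c = 1"
  defines "a \<equiv> (c - 1) / complex_of_real (inner v v)"
  shows "mat 1 + (\<chi> i j. a * v $ i * cnj (v $ j)) \<in> unitary_group"
proof -
  define W :: "complex ^ 'n ^ 'n" where "W = mat 1 + (\<chi> i j. a * v $ i * cnj (v $ j))"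
  define s where "s = complex_of_real (inner v v)"
  have s: "(\<Sum>k\<in>UNIV. v $ k * cnj (v $ k)) = s"
    by (simp add: s_def inner_vec_def inner_complex_def complex_eq_iff)
  have "s \<noteq> 0" using assms(1) by (simp add: s_def)
  have cc: "c * cnj c = 1" using c by (simp add: complex_norm_square[symmetric])
  have "cnj s = s" by (simp add: s_def)
  \<comment> \<open>This is the coefficient of the rank-one part of \<open>dagger W ** W\<close>; it
    equals (|c|^2 - 1) / s.\<close>
  then have coef: "a + cnj a + a * cnj a * s = 0"
    using \<open>s \<noteq> 0\<close> cc unfolding a_def s_def[symmetric]
    by (simp add: field_simps)
  have "(dagger W ** W) $ i $ j = (mat 1 :: complex ^ 'n ^ 'n) $ i $ j" for i j
  proof -
    have "(dagger W ** W) $ i $ j = (\<Sum>k\<in>UNIV.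
        cnj (mat 1 $ k $ i + a * v $ k * cnj (v $ i)) * (mat 1 $ k $ j + a * v $ k * cnj (v $ j)))"
      by (simp add: matrix_matrix_mult_def dagger_def W_def)
    also have "\<dots> = (\<Sum>k\<in>UNIV. (if k = i then mat 1 $ i $ j + a * v $ i * cnj (v $ j) else 0)
        + (if k = j then cnj a * cnj (v $ j) * v $ i else 0)
        + a * cnj a * v $ i * cnj (v $ j) * (v $ k * cnj (v $ k)))"
      by (intro sum.cong) (auto simp: mat_def algebra_simps)
    also have "\<dots> = mat 1 $ i $ j + (a + cnj a + a * cnj a * s) * v $ i * cnj (v $ j)"
      by (simp add: sum.distrib s flip: sum_distrib_left) (simp add: algebra_simps)
    finally show ?thesis by (simp add: coef)
  qed
  then have "dagger W ** W = mat 1" by (simp add: vec_eq_iff)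
  then show ?thesis
    using matrix_left_right_inverse[of "dagger W" W] by (simp add: unitary_group_def W_def)
qed

lemma hermitian_if_quadratic_form_real:
  fixes P :: "complex ^ 'n ^ 'n"
  assumes "\<And>v. Im (\<Sum>i\<in>UNIV. cnj (v $ i) * (P *v v) $ i) = 0"
  shows "dagger P = P"
proof -
  have form: "(\<Sum>k\<in>UNIV. cnj (v $ k) * (P *v v) $ k)
      = P $ i $ i + c * P $ i $ j + cnj c * P $ j $ i + cnj c * c * P $ j $ j"
    if "v = axis i 1 + c *s axis j 1" for v i j c
  proof -
    have v: "v $ k = (if k = i then 1 else 0) + (if k = j then c else 0)" for k
      by (auto simp: that axis_def)
    have Pv: "(P *v v) $ k = P $ k $ i + c * P $ k $ j" for k
    proof -
      have "(P *v v) $ k = (\<Sum>l\<in>UNIV. (if l = i then P $ k $ i else 0) + (if l = j then c * P $ k $ j else 0))"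
        unfolding matrix_vector_mult_def by (auto intro!: sum.cong simp: v algebra_simps)
      then show ?thesis by (simp add: sum.distrib)
    qed
    have "(\<Sum>k\<in>UNIV. cnj (v $ k) * (P *v v) $ k) = (\<Sum>k\<in>UNIV. (if k = i then (P *v v) $ i else 0)
       + (if k = j then cnj c * (P *v v) $ j else 0))"
      by (intro sum.cong) (auto simp: v algebra_simps)
    then show ?thesis by (simp add: sum.distrib Pv algebra_simps)
  qed
  have im: "Im (P $ i $ i + c * P $ i $ j + cnj c * P $ j $ i + cnj c * c * P $ j $ j) = 0" for i j c
    using assms by (metis form)
  \<comment> \<open>Polarization: \<open>c = 0\<close> makes the diagonal real, \<open>c = 1\<close>
    compares the imaginary parts of \<open>P $ i $ j\<close> and \<open>P $ j $ i\<close>, and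
    \<open>c = \<i>\<close> their real parts.\<close>
  have diag: "Im (P $ i $ i) = 0" for i
    using im[of i 0 i] by simp
  have "cnj (P $ j $ i) = P $ i $ j" for i j
    using im[of i 1 j] im[of i \<i> j] diag[of i] diag[of j]
    by (simp add: complex_eq_iff)
  then show ?thesis by (simp add: dagger_def vec_eq_iff)
qed

lemma psd_if_mat_1_maximal:
  fixes P :: "complex ^ 'n ^ 'n"
  assumes max: "\<And>W. W \<in> unitary_group \<Longrightarrow> inner W P \<le> inner (mat 1) P"
  shows "psd P"
proof -
  define z where "z v = (\<Sum>i\<in>UNIV. cnj (v $ i) * (P *v v) $ i)" for v
  \<comment> \<open>Equality with its own modulus makes the form both real, which gives that
    \<open>P\<close> is Hermitian, and nonnegative.\<close>
  have z: "z v = complex_of_real (cmod (z v))" for v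
  proof (cases "v = 0 \<or> z v = 0")
    case True
    then show ?thesis by (auto simp: z_def)
  next
    case False
    \<comment> \<open>Test with the unitary that multiplies \<open>v\<close> by the phase \<open>c\<close> of \<open>v\<^sup>* P v\<close>; maximality gives \<open>\<bar>v\<^sup>* P v\<bar> \<le> Re (v\<^sup>* P v)\<close>.\<close>
    define c where "c = z v / complex_of_real (cmod (z v))"
    define a where "a = (c - 1) / complex_of_real (inner v v)"
    have "cmod c = 1" using False by (simp add: c_def norm_divide)
    then have "inner (mat 1 + (\<chi> i j. a * v $ i * cnj (v $ j))) P \<le> inner (mat 1) P"
      unfolding a_def using False by (intro max unitary_rank_one_update) auto
    moreover have "inner (\<chi> i j. a * v $ i * cnj (v $ j)) P = Re (cnj a * z v)"
      unfolding inner_matrix_cnj z_def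
      by (simp add: matrix_vector_mult_def sum_distrib_left mult_ac del: Re_sum times_complex.sel)
    \<comment> \<open>The factor \<open>cnj c\<close> rotates \<open>z v\<close> onto the positive
      real axis, so the real part of this gain is nonnegative, while maximality makes it at most
      zero.\<close>
    moreover have "cnj a * z v = (complex_of_real (cmod (z v)) - z v) / complex_of_real (inner v v)"
    proof -
      have "cnj c * z v = complex_of_real (cmod (z v))"
        using False complex_norm_square[of "z v"]
        by (simp add: c_def field_simps power2_eq_square)
      then show ?thesis by (simp add: a_def algebra_simps diff_divide_distrib)
    qed
    ultimately have "(cmod (z v) - Re (z v)) / inner v v \<le> 0"
      by (simp add: inner_add_left)
    moreover have "inner v v > 0" using False by simp
    ultimately have "cmod (z v) \<le> Re (z v)"
      by (simp add: divide_le_0_iff)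
    then have "Re (z v) = cmod (z v)"
      using complex_Re_le_cmod[of "z v"] by simp
    moreover from this have "Im (z v) = 0" using cmod_power2[of "z v"] by simp
    ultimately show ?thesis by (simp add: complex_eq_iff)
  qed
  have "Im (z v) = 0" "0 \<le> Re (z v)" for v by (subst z, simp)+
  then show ?thesis
    using hermitian_if_quadratic_form_real[of P] by (simp add: psd_def z_def)
qed

lemma trace_norm_variational:
  fixes G :: "complex ^ 'n ^ 'n"
  obtains X where "X \<in> unitary_group" "inner X G = trace_norm G"
    "\<And>Y. Y \<in> unitary_group \<Longrightarrow> inner Y G \<le> inner X G"
proof -
  have "\<exists>X\<in>unitary_group. \<forall>Y\<in>unitary_group. inner Y G \<le> inner X G"
    using mat_1_unitary
    by (intro continuous_attains_sup compact_unitary_group continuous_intros) auto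
  then obtain X where X: "X \<in> unitary_group"
    and max: "\<And>Y. Y \<in> unitary_group \<Longrightarrow> inner Y G \<le> inner X G" by blast
  define P where "P = dagger X ** G"
  \<comment> \<open>As \<open>X ** W\<close> is unitary for every unitary \<open>W\<close>,
    maximality of \<open>X\<close> for \<open>G\<close> becomes maximality of \<open>mat 1\<close>
    for \<open>P\<close>.\<close>
  have eq: "inner W P = inner (X ** W) G" for W
    by (simp add: P_def inner_matrix_mult_left)
  have P: "psd P"
    by (rule psd_if_mat_1_maximal) (simp add: eq max mult_unitary X)
  then have "P ** P = dagger P ** P" by (simp add: psd_def)
  also have "\<dots> = dagger G ** (X ** dagger X) ** G"
    by (simp add: P_def dagger_mult matrix_mul_assoc)
  also have "\<dots> = dagger G ** G" using X by (simp add: unitary_group_def)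
  finally have "psd_sqrt (dagger G ** G) = P"
    using psd_sqrt_square[OF P] by simp
  then have "inner X G = trace_norm G"
    by (simp add: trace_norm_def inner_matrix_trace P_def)
  with X max show ?thesis using that by blast
qed

section \<open>The partial trace as the adjoint of tensoring with the identity, and the distance
  formula\<close>

lemma inner_kron_1:
  fixes M :: "complex ^ ('s::finite \<times> 'e::finite) ^ ('s \<times> 'e)"
  shows "inner (mat 1 \<otimes> A) M = inner A (ptrace_s M)"
proof -
  have sum_prod: "(\<Sum>p\<in>UNIV. f p) = (\<Sum>k\<in>UNIV. \<Sum>i\<in>UNIV. f (k, i))"
    for f :: "'s \<times> 'e \<Rightarrow> real"
    by (simp add: sum.cartesian_product)
  have "inner (mat 1 \<otimes> A) M = (\<Sum>k\<in>UNIV. \<Sum>i\<in>UNIV. \<Sum>l\<in>UNIV. \<Sum>j\<in>UNIV.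
      inner ((mat 1 :: complex ^ 's ^ 's) $ k $ l * A $ i $ j) (M $ (k, i) $ (l, j)))"
    by (simp add: inner_vec_def kron_def sum_prod)
  \<comment> \<open>The identity factor keeps only the blocks with \<open>l = k\<close>, exactly
    those that \<open>ptrace_s\<close> adds up.\<close>
  also have "\<dots> = (\<Sum>k\<in>UNIV. \<Sum>i\<in>UNIV. \<Sum>l\<in>UNIV. if l = k then
      \<Sum>j\<in>UNIV. inner (A $ i $ j) (M $ (k, i) $ (k, j)) else 0)"
    by (intro sum.cong) (auto simp: mat_def)
  also have "\<dots> = (\<Sum>k\<in>UNIV. \<Sum>i\<in>UNIV. \<Sum>j\<in>UNIV. inner (A $ i $ j) (M $ (k, i) $ (k, j)))"
    by simp
  also have "\<dots> = (\<Sum>i\<in>UNIV. \<Sum>j\<in>UNIV. \<Sum>k\<in>UNIV. inner (A $ i $ j) (M $ (k, i) $ (k, j)))"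
    by (subst sum.swap, intro sum.cong refl, rule sum.swap)
  also have "\<dots> = inner A (ptrace_s M)"
    by (simp add: inner_vec_def ptrace_s_def inner_sum_right)
  finally show ?thesis .
qed

text \<open>Both unitaries have the same squared norm, so only the cross term depends on
  \<open>\<Phi>\<close>. Moving \<open>V\<close> to the other side of the inner product and then
  taking the adjoint of tensoring produces the partial trace.\<close>

lemma hs_norm_diff_kron_1:
  fixes U V :: "complex ^ ('s::finite \<times> 'e::finite) ^ ('s \<times> 'e)"
  assumes "U \<in> unitary_group" "V \<in> unitary_group" "\<Phi> \<in> unitary_group"
  shows "hs_norm (U - (mat 1 \<otimes> \<Phi>) ** V)
    = sqrt (2 * (real CARD('s) * real CARD('e)) - 2 * inner \<Phi> (ptrace_s (U ** dagger V)))"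
proof -
  let ?W = "(mat 1 \<otimes> \<Phi>) ** V"
  have "inner U U = real CARD('s) * real CARD('e)" "inner ?W ?W = real CARD('s) * real CARD('e)"
    using assms by (simp_all add: inner_unitary_self mult_unitary kron_1_unitary)
  moreover have "inner ?W U = inner \<Phi> (ptrace_s (U ** dagger V))"
    by (simp add: inner_matrix_mult_right inner_kron_1)
  ultimately show ?thesis
    by (simp add: hs_norm_eq_norm norm_eq_sqrt_inner inner_diff_left inner_diff_right inner_commute)
qed

theorem mainTheorem2:
  fixes U V :: "complex ^ ('s::finite \<times> 'e::finite) ^ ('s \<times> 'e)"
  assumes "U \<in> unitary_group" and "V \<in> unitary_group"
  shows "(\<exists>\<Phi>. is_arg_min (\<lambda>\<Phi>. hs_norm (U - (mat 1 \<otimes> \<Phi>) ** V)) (\<lambda>\<Phi>. \<Phi> \<in> unitary_group) \<Phi>)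
    \<and> hs_quotient_dist (operator_class U) (operator_class V)
      = sqrt (1 - 1 / (real CARD('s) * real CARD('e)) * trace_norm (ptrace_s (U ** dagger V)))"
proof -
  define G where "G = ptrace_s (U ** dagger V)"
  define n where "n = real CARD('s) * real CARD('e)"
  have n: "n > 0" by (simp add: n_def)
  note hs = hs_norm_diff_kron_1[OF assms, folded G_def n_def]
  obtain X where X: "X \<in> unitary_group" "inner X G = trace_norm G"
    and max: "\<And>Y. Y \<in> unitary_group \<Longrightarrow> inner Y G \<le> inner X G"
    using trace_norm_variational[of G] by blast
  have min: "hs_norm (U - (mat 1 \<otimes> X) ** V) \<le> hs_norm (U - (mat 1 \<otimes> Y) ** V)"
    if "Y \<in> unitary_group" for Y
    using that X(1) max by (simp add: hs)
  have "is_arg_min (\<lambda>\<Phi>. hs_norm (U - (mat 1 \<otimes> \<Phi>) ** V)) (\<lambda>\<Phi>. \<Phi> \<in> unitary_group) X"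
    using X(1) min by (force simp: is_arg_min_linorder)
  \<comment> \<open>The maximizer \<open>X\<close> attains the minimum, so \<open>LEAST\<close> has
    its intended value here.\<close>
  moreover have "(LEAST d. \<exists>\<Phi> \<in> unitary_group. d = hs_norm (U - (mat 1 \<otimes> \<Phi>) ** V))
      = sqrt (2 * n - 2 * trace_norm G)"
    using X min by (intro Least_equality) (auto simp flip: hs X(2))
  then have "hs_rep_dist U V = 1 / sqrt (2 * n) * sqrt (2 * n - 2 * trace_norm G)"
    by (simp add: hs_rep_dist_def n_def)
  then have "hs_rep_dist U V = sqrt (1 - 1 / n * trace_norm G)"
    using n by (simp add: diff_divide_distrib flip: real_sqrt_divide)
  ultimately show ?thesis
    using hs_quotient_dist_operator_class[OF assms] by (auto simp: G_def n_def)
qed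

end
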